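(* Let $(X,d)$ be a finite nonempty ultrametric space. Every minimum spanning tree of $X$ is a path if and only if the representing tree $T_X$ is isomorphic, as a rooted tree, to one of the following rooted trees $T_1,\dots,T_5$: $T_1$: the root has exactly two children, each of which has exactly two children, and these four grandchildren of the root are leaves; $T_2$: the root has exactly two children, one of which is a leaf and the other of which has exactly two children, both leaves; $T_3$: the root has exactly two children, both leaves; $T_4$: the root has exactly three children, all leaves; $T_5$: the tree consisting of the root only.
   Context: An ultrametric space $(X,d)$ is a metric space with $d(x,y)\le\max\{d(x,z),d(z,y)\}$ for all $x,y,z$. Minimum spanning tree: a finite metric space $(X,d)$ is regarded as the complete weighted graph $(G_X,w)$ with $V(G_X)=X$ and $w(\{x,y\})=d(x,y)$ for $x\ne y$. A minimum spanning tree of $(X,d)$ is a spanning tree of $G_X$ whose sum of edge weights is smallest among all spanning trees of $(G_X,w)$. A path is a nonempty graph whose vertices can be numbered $x_1,\dots,x_k$ (distinct) so that its edges are exactly $\{x_1,x_2\},\dots,\{x_{k-1},x_k\}$ (a single vertex is allowed). Representing tree: for a finite ultrametric space $X$ with $|X|\ge 2$, the diametrical graph $G_{D,X}$ has vertex set $X$, with $u,v$ adjacent iff $d(u,v)=\operatorname{diam}X$; it is known to be a complete multipartite graph with parts $X_1,\dots,X_k$, $k\ge2$ (the parts are the classes of the equivalence relation $d(u,v)<\operatorname{diam}X$). The representing tree $T_X$ is the labeled rooted tree whose nodes are subsets of $X$, constructed as follows: the root is $X$ with label $\operatorname{diam}X$; if $|X|=1$, $T_X$ consists of the root only (a leaf,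 with label $0$); if $|X|\ge2$, the children of the root are the parts $X_1,\dots,X_k$ of $G_{D,X}$, each labeled $l(X_i)=\operatorname{diam}X_i$; nodes of label $0$ (singletons) are leaves, and the construction is repeated at each node $X_i$ with $\operatorname{diam}X_i>0$, using the subspace $X_i$ in place of $X$, and so on. Isomorphism as rooted trees is graph isomorphism sending root to root (labels are ignored). *)

theory Defs
  imports "HOL-Analysis.Analysis"
begin

section \<open>Simple undirected graphs\<close>

record 'v ugraph =
  verts :: "'v set"
  edges :: "'v set set"

definition simple_graph :: "('v, 'b) ugraph_scheme \<Rightarrow> bool" where
  "simple_graph G \<longleftrightarrow>
     edges G \<subseteq> {{x, y} | x y. x \<in> verts G \<and> y \<in> verts G \<and> x \<noteq> y}"

definition complete_graph :: "'v set \<Rightarrow> 'v ugraph" where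
  "complete_graph V =
     \<lparr>verts = V, edges = {{x, y} | x y. x \<in> V \<and> y \<in> V \<and> x \<noteq> y}\<rparr>"

definition steps :: "'v list \<Rightarrow> 'v set set" where
  "steps xs = {{xs ! i, xs ! Suc i} | i. Suc i < length xs}"

definition is_path :: "('v, 'b) ugraph_scheme \<Rightarrow> bool" where
  "is_path G \<longleftrightarrow>
     (\<exists>xs. xs \<noteq> [] \<and> distinct xs \<and> verts G = set xs \<and> edges G = steps xs)"

definition connected_graph :: "('v, 'b) ugraph_scheme \<Rightarrow> bool" where
  "connected_graph G \<longleftrightarrow>
     verts G \<noteq> {} \<and>
     (\<forall>u \<in> verts G. \<forall>v \<in> verts G.
        \<exists>xs. xs \<noteq> [] \<and> set xs \<subseteq> verts G \<and> steps xs \<subseteq> edges G \<and> hd xs = u \<and> last xs = v)"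

definition has_cycle :: "('v, 'b) ugraph_scheme \<Rightarrow> bool" where
  "has_cycle G \<longleftrightarrow>
     (\<exists>xs. 3 \<le> length xs \<and> distinct xs \<and> set xs \<subseteq> verts G \<and>
           steps xs \<subseteq> edges G \<and> {last xs, hd xs} \<in> edges G)"

definition is_tree :: "('v, 'b) ugraph_scheme \<Rightarrow> bool" where
  "is_tree G \<longleftrightarrow> simple_graph G \<and> connected_graph G \<and> \<not> has_cycle G"

definition spanning_tree :: "'v ugraph \<Rightarrow> 'v ugraph \<Rightarrow> bool" where
  "spanning_tree G T \<longleftrightarrow> is_tree T \<and> verts T = verts G \<and> edges T \<subseteq> edges G"


section \<open>Finite ultrametric spaces and their minimum spanning trees\<close>

locale ultrametric_space = Metric_space +
  assumes ultrametric:
    "\<lbrakk>x \<in> M; y \<in> M; z \<in> M\<rbrakk> \<Longrightarrow> d x y \<le> max (d x z) (d z y)"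

text \<open>Unambiguous on two-element sets because \<open>d\<close> is symmetric; see
  \<open>Metric_space.edge_weight_doubleton\<close> below.\<close>

definition edge_weight :: "('a \<Rightarrow> 'a \<Rightarrow> real) \<Rightarrow> 'a set \<Rightarrow> real" where
  "edge_weight d e = (THE w. \<exists>x y. e = {x, y} \<and> x \<noteq> y \<and> w = d x y)"

definition total_weight :: "('a \<Rightarrow> 'a \<Rightarrow> real) \<Rightarrow> 'a ugraph \<Rightarrow> real" where
  "total_weight d G = (\<Sum>e \<in> edges G. edge_weight d e)"

definition minimum_spanning_tree ::
    "'a set \<Rightarrow> ('a \<Rightarrow> 'a \<Rightarrow> real) \<Rightarrow> 'a ugraph \<Rightarrow> bool" where
  "minimum_spanning_tree X d T \<longleftrightarrow>
     spanning_tree (complete_graph X) T \<and>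
     (\<forall>S. spanning_tree (complete_graph X) S \<longrightarrow> total_weight d T \<le> total_weight d S)"

lemma (in Metric_space) edge_weight_doubleton:
  "x \<noteq> y \<Longrightarrow> edge_weight d {x, y} = d x y"
  unfolding edge_weight_def
  by (rule the_equality) (auto simp: doubleton_eq_iff commute)


section \<open>Representing trees\<close>

definition diam :: "('a \<Rightarrow> 'a \<Rightarrow> real) \<Rightarrow> 'a set \<Rightarrow> real" where
  "diam d A = (if A = {} then 0 else SUP (x, y) \<in> A \<times> A. d x y)"

definition diametrical_graph :: "('a \<Rightarrow> 'a \<Rightarrow> real) \<Rightarrow> 'a set \<Rightarrow> 'a ugraph" where
  "diametrical_graph d A =
     \<lparr>verts = A,
      edges = {{u, v} | u v. u \<in> A \<and> v \<in> A \<and> u \<noteq> v \<and> d u v = diam d A}\<rparr>"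

text \<open>The parts of a complete multipartite graph are the classes of non-adjacency. That
  diametrical graphs of finite ultrametric spaces are complete multipartite, with these
  parts, is \<open>ultrametric_space.diametrical_graph_parts\<close> below.\<close>

definition parts :: "'v ugraph \<Rightarrow> 'v set set" where
  "parts G = verts G // {(u, v). u \<in> verts G \<and> v \<in> verts G \<and> {u, v} \<notin> edges G}"

inductive_set rep_nodes :: "'a set \<Rightarrow> ('a \<Rightarrow> 'a \<Rightarrow> real) \<Rightarrow> 'a set set"
  for X :: "'a set" and d :: "'a \<Rightarrow> 'a \<Rightarrow> real" where
  root: "X \<in> rep_nodes X d"
| child: "\<lbrakk>A \<in> rep_nodes X d; 0 < diam d A; C \<in> parts (diametrical_graph d A)\<rbrakk>
           \<Longrightarrow> C \<in> rep_nodes X d"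

record 'v rooted_graph = "'v ugraph" +
  root_of :: 'v

record 'v labeled_rooted_graph = "'v rooted_graph" +
  label :: "'v \<Rightarrow> real"

definition representing_tree ::
    "'a set \<Rightarrow> ('a \<Rightarrow> 'a \<Rightarrow> real) \<Rightarrow> 'a set labeled_rooted_graph" where
  "representing_tree X d =
     \<lparr>verts = rep_nodes X d,
      edges = {{A, C} | A C. A \<in> rep_nodes X d \<and> 0 < diam d A \<and>
                             C \<in> parts (diametrical_graph d A)},
      root_of = X,
      label = diam d\<rparr>"

definition rooted_iso ::
    "('v, 'b) rooted_graph_scheme \<Rightarrow> ('w, 'c) rooted_graph_scheme \<Rightarrow> bool" where
  "rooted_iso G H \<longleftrightarrow>
     (\<exists>f. bij_betw f (verts G) (verts H) \<and> f (root_of G) = root_of H \<and>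
          (\<forall>u \<in> verts G. \<forall>v \<in> verts G. {u, v} \<in> edges G \<longleftrightarrow> {f u, f v} \<in> edges H))"

definition T1 :: "nat rooted_graph" where
  "T1 = \<lparr>verts = {0, 1, 2, 3, 4, 5, 6},
         edges = {{0, 1}, {0, 2}, {1, 3}, {1, 4}, {2, 5}, {2, 6}}, root_of = 0\<rparr>"

definition T2 :: "nat rooted_graph" where
  "T2 = \<lparr>verts = {0, 1, 2, 3, 4}, edges = {{0, 1}, {0, 2}, {2, 3}, {2, 4}}, root_of = 0\<rparr>"

definition T3 :: "nat rooted_graph" where
  "T3 = \<lparr>verts = {0, 1, 2}, edges = {{0, 1}, {0, 2}}, root_of = 0\<rparr>"

definition T4 :: "nat rooted_graph" where
  "T4 = \<lparr>verts = {0, 1, 2, 3}, edges = {{0, 1}, {0, 2}, {0, 3}}, root_of = 0\<rparr>"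

definition T5 :: "nat rooted_graph" where
  "T5 = \<lparr>verts = {0}, edges = {}, root_of = 0\<rparr>"

context ultrametric_space
begin

lemma diam_upper:
  assumes "finite A" "x \<in> A" "y \<in> A"
  shows "d x y \<le> diam d A"
proof -
  have "d x y \<le> (SUP (x, y) \<in> A \<times> A. d x y)"
    by (rule cSUP_upper2[of _ _ "(x, y)"])
       (use assms in \<open>auto intro!: bdd_above_finite finite_imageI\<close>)
  then show ?thesis
    using assms by (auto simp: diam_def)
qed

lemma diam_attained:
  assumes "finite A" "A \<noteq> {}"
  obtains x y where "x \<in> A" "y \<in> A" "d x y = diam d A"
proof -
  have "Sup ((\<lambda>(x, y). d x y) ` (A \<times> A)) \<in> (\<lambda>(x, y). d x y) ` (A \<times> A)"
    by (subst cSup_eq_Max) (use assms in \<open>auto intro!: Max_in\<close>)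
  then obtain x y where "x \<in> A" "y \<in> A" "Sup ((\<lambda>(x, y). d x y) ` (A \<times> A)) = d x y"
    by auto
  with that[of x y] assms show ?thesis
    by (simp add: diam_def)
qed

lemma nonadjacent_iff:
  assumes "finite A" "0 < diam d A" "A \<subseteq> M" "u \<in> A" "v \<in> A"
  shows "{u, v} \<notin> edges (diametrical_graph d A) \<longleftrightarrow> d u v < diam d A"
proof -
  have "{u, v} \<in> edges (diametrical_graph d A) \<longleftrightarrow> u \<noteq> v \<and> d u v = diam d A"
    using assms(4,5) by (auto simp: diametrical_graph_def doubleton_eq_iff commute)
  moreover have "d u v = 0" if "u = v"
    using assms(3,4) that by auto
  ultimately show ?thesis
    using diam_upper[OF assms(1,4,5)] assms(2) by fastforce
qed

lemma equiv_less_diam: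
  assumes "finite A" "0 < diam d A" "A \<subseteq> M"
  shows "equiv A {(u, v). u \<in> A \<and> v \<in> A \<and> d u v < diam d A}"
proof (rule equivI)
  show "trans {(u, v). u \<in> A \<and> v \<in> A \<and> d u v < diam d A}"
  proof (rule transI, clarsimp)
    fix x y z assume "x \<in> A" "y \<in> A" "z \<in> A" "d x y < diam d A" "d y z < diam d A"
    then show "d x z < diam d A"
      using ultrametric[of x z y] assms(3) by (auto simp: subset_iff)
  qed
qed (use assms in \<open>auto intro!: refl_onI symI simp: commute\<close>)

lemma parts_diametrical_graph:
  assumes "finite A" "0 < diam d A" "A \<subseteq> M"
  shows "parts (diametrical_graph d A) =
         A // {(u, v). u \<in> A \<and> v \<in> A \<and> d u v < diam d A}"
proof -
  have "{(u, v). u \<in> A \<and> v \<in> A \<and> {u, v} \<notin> edges (diametrical_graph d A)} =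
        {(u, v). u \<in> A \<and> v \<in> A \<and> d u v < diam d A}"
    using nonadjacent_iff[OF assms] by auto
  moreover have "verts (diametrical_graph d A) = A"
    by (simp add: diametrical_graph_def)
  ultimately show ?thesis
    by (simp add: parts_def)
qed

lemma diametrical_graph_parts:
  assumes "finite A" "0 < diam d A" "A \<subseteq> M"
  shows "partition_on A (parts (diametrical_graph d A))"
    and "2 \<le> card (parts (diametrical_graph d A))"
    and "edges (diametrical_graph d A) =
         {{u, v} | u v. \<exists>C \<in> parts (diametrical_graph d A). \<exists>D \<in> parts (diametrical_graph d A).
            C \<noteq> D \<and> u \<in> C \<and> v \<in> D}"
proof -
  let ?P = "parts (diametrical_graph d A)"
  let ?r = "{(u, v). u \<in> A \<and> v \<in> A \<and> d u v < diam d A}"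
  note P = parts_diametrical_graph[OF assms]
  note eq = equiv_less_diam[OF assms]
  show "partition_on A ?P"
    unfolding P by (rule partition_on_quotient[OF eq])
  have different: "d u v = diam d A \<longleftrightarrow> ?r `` {u} \<noteq> ?r `` {v}" if "u \<in> A" "v \<in> A" for u v
    using eq_equiv_class_iff[OF eq that] diam_upper[OF assms(1) that] that by auto
  have "A \<noteq> {}"
    using assms(2) by (auto simp: diam_def)
  then obtain x y where xy: "x \<in> A" "y \<in> A" "d x y = diam d A"
    using diam_attained[OF assms(1)] by blast
  have "card {?r `` {x}, ?r `` {y}} \<le> card ?P"
    unfolding P
    by (rule card_mono)
      (use quotientI[OF xy(1), of ?r] quotientI[OF xy(2), of ?r] assms(1)
       in \<open>auto simp: quotient_def\<close>)
  moreover have "?r `` {x} \<noteq> ?r `` {y}"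
    using different[OF xy(1,2)] xy(3) by simp
  ultimately show "2 \<le> card ?P"
    by simp
  have cls: "C = ?r `` {u} \<and> u \<in> A" if "C \<in> ?P" "u \<in> C" for C u
  proof -
    obtain w where w: "w \<in> A" "C = ?r `` {w}"
      using \<open>C \<in> ?P\<close> unfolding P by (rule quotientE)
    then have "(w, u) \<in> ?r"
      using \<open>u \<in> C\<close> by simp
    then show ?thesis
      using equiv_class_eq[OF eq] w by auto
  qed
  have self: "u \<in> ?r `` {u}" "?r `` {u} \<in> ?P" if "u \<in> A" for u
    unfolding P by (rule equiv_class_self[OF eq that], rule quotientI[OF that])
  have across: "(\<exists>C \<in> ?P. \<exists>D \<in> ?P. C \<noteq> D \<and> u \<in> C \<and> v \<in> D) \<longleftrightarrow>
        u \<in> A \<and> v \<in> A \<and> d u v = diam d A" for u v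
  proof
    assume "\<exists>C \<in> ?P. \<exists>D \<in> ?P. C \<noteq> D \<and> u \<in> C \<and> v \<in> D"
    then obtain C D where CD: "C \<in> ?P" "D \<in> ?P" "C \<noteq> D" "u \<in> C" "v \<in> D"
      by blast
    then show "u \<in> A \<and> v \<in> A \<and> d u v = diam d A"
      using cls[OF CD(1,4)] cls[OF CD(2,5)] different[of u v] by simp
  next
    assume *: "u \<in> A \<and> v \<in> A \<and> d u v = diam d A"
    then have "?r `` {u} \<noteq> ?r `` {v}"
      using different[of u v] by blast
    with * show "\<exists>C \<in> ?P. \<exists>D \<in> ?P. C \<noteq> D \<and> u \<in> C \<and> v \<in> D"
      by (intro bexI[of _ "?r `` {u}"] bexI[of _ "?r `` {v}"] conjI self) simp_all
  qed
  have distinct: "u \<noteq> v" if "u \<in> A" "d u v = diam d A" for u v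
    using assms(2,3) that by (auto simp: subset_iff)
  have "(u \<in> A \<and> v \<in> A \<and> u \<noteq> v \<and> d u v = diam d A) =
        (\<exists>C \<in> ?P. \<exists>D \<in> ?P. C \<noteq> D \<and> u \<in> C \<and> v \<in> D)" for u v
    unfolding across using distinct[of u v] by fast
  moreover have "edges (diametrical_graph d A) =
      {{u, v} | u v. u \<in> A \<and> v \<in> A \<and> u \<noteq> v \<and> d u v = diam d A}"
    by (simp add: diametrical_graph_def)
  ultimately show "edges (diametrical_graph d A) =
         {{u, v} | u v. \<exists>C \<in> ?P. \<exists>D \<in> ?P. C \<noteq> D \<and> u \<in> C \<and> v \<in> D}"
    by (simp only:)
qed

end

end

theory Submission
  imports Defs
begin

text \<open>
  Both sides of the equivalence say that the space has at most three points or consists of two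
  close pairs \<open>{a, b}\<close>, \<open>{c, e}\<close> such that the two distances within the pairs are smaller than all
  distances across (\<open>two_close_pairs\<close>).

  Suppose that every minimum spanning tree is a path, let \<open>x\<^sub>0, \<dots>, x\<^sub>n\<close> be such a path, and let
  \<open>3 \<le> j \<le> n\<close>. If the edge \<open>x\<^bsub>j-1\<^esub> x\<^bsub>j\<^esub>\<close> were at least as long as its predecessor, then by the
  ultrametric inequality it could be exchanged for \<open>x\<^bsub>j-2\<^esub> x\<^bsub>j\<^esub>\<close> without extra weight, and
  \<open>x\<^bsub>j-2\<^esub>\<close> would get a third neighbour. So from its second edge on, the path has strictly decreasing
  weights (\<open>weights_decrease_along_path\<close>); read backwards, it has the same property. On five or more
  points the second and the third edge would each be shorter than the other; on four points the middle
  edge is longer than both others, which gives two close pairs.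

  Conversely, a tree that is not a path has a vertex with three neighbours
  (\<open>non_path_tree_has_branch\<close>), hence at least four vertices; on two close pairs it is a star, which
  is heavier than a suitable path (\<open>star_not_minimal\<close>).

  On the side of the representing trees, such spaces are small enough for the tree to be computed.
  In the other direction, an isomorphism maps the parts of a node to neighbours of its image other
  than the root. This bounds the number of points of each node from the leaves upwards
  (\<open>card_node\<close>): \<open>T2\<close> to \<open>T5\<close> allow at most three points and \<open>T1\<close> at most four, with at most two in
  each part of the space.
\<close>

section \<open>Walks, paths and cycles\<close>

lemma steps_Nil [simp]: "steps [] = {}"
  by (simp add: steps_def)

lemma steps_single [simp]: "steps [x] = {}"
  by (simp add: steps_def)

lemma steps_Cons_Cons [simp]: "steps (x # y # zs) = insert {x, y} (steps (y # zs))"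
proof -
  have image: "steps xs = (\<lambda>i. {xs ! i, xs ! Suc i}) ` {..<length xs - 1}" for xs :: "'a list"
    by (auto simp: steps_def less_diff_conv)
  show ?thesis
    unfolding image by (simp add: lessThan_Suc_eq_insert_0 image_image)
qed

lemma steps_append_single: "xs \<noteq> [] \<Longrightarrow> steps (xs @ [v]) = insert {last xs, v} (steps xs)"
proof (induction xs)
  case (Cons x xs)
  then show ?case by (cases xs) (auto simp: insert_commute)
qed simp

lemma steps_segment: "steps (take m (drop k xs)) \<subseteq> steps xs"
proof
  fix e assume "e \<in> steps (take m (drop k xs))"
  then obtain i where i: "Suc i < length (take m (drop k xs))"
      "e = {take m (drop k xs) ! i, take m (drop k xs) ! Suc i}"
    unfolding steps_def by blast
  have "Suc (k + i) < length xs"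
    using i(1) by auto
  then have "e = {xs ! (k + i), xs ! Suc (k + i)} \<and> Suc (k + i) < length xs"
    using i by simp
  then show "e \<in> steps xs"
    unfolding steps_def by (intro CollectI exI[of _ "k + i"])
qed

lemma steps_rev: "steps (rev xs) = steps xs"
proof (induction xs)
  case (Cons x xs)
  show ?case
  proof (cases xs)
    case (Cons y ys)
    then show ?thesis
      using Cons.IH steps_append_single[of "rev xs" x] by (auto simp: last_rev insert_commute)
  qed simp
qed simp

text \<open>Reachability relations compose and reverse more smoothly than walks given as lists, so
  connectedness is established through the closure and turned into a list only here.\<close>

lemma walk_of_rtrancl:
  assumes "(u, v) \<in> {(x, y). x \<in> V \<and> y \<in> V \<and> {x, y} \<in> E}\<^sup>*" "v \<in> V"
  shows "\<exists>xs. xs \<noteq> [] \<and> set xs \<subseteq> V \<and> steps xs \<subseteq> E \<and> hd xs = u \<and> last xs = v"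
  using assms(1)
proof (induction rule: converse_rtrancl_induct)
  case base
  then show ?case
    using assms(2) by (intro exI[of _ "[v]"]) simp
next
  case (step y z)
  obtain xs where xs: "xs \<noteq> []" "set xs \<subseteq> V" "steps xs \<subseteq> E" "hd xs = z" "last xs = v"
    using step.IH by (elim exE conjE)
  have "y \<in> V" "{y, z} \<in> E"
    using step.hyps(1) by auto
  then show ?case
    using xs by (intro exI[of _ "y # xs"]) (cases xs; simp)
qed

lemma walk_crosses_boundary:
  assumes "xs \<noteq> []" "hd xs \<in> S" "last xs \<notin> S"
  shows "\<exists>u v. u \<in> S \<and> v \<notin> S \<and> v \<in> set xs \<and> {u, v} \<in> steps xs"
  using assms
proof (induction xs rule: induct_list012)
  case (3 x y zs)
  show ?case
  proof (cases "y \<in> S")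
    case True
    then obtain u v where "u \<in> S" "v \<notin> S" "v \<in> set (y # zs)" "{u, v} \<in> steps (y # zs)"
      using "3.IH"(2) "3.prems" by auto
    then show ?thesis
      by (intro exI[of _ u] exI[of _ v]) simp
  next
    case False
    then show ?thesis
      using "3.prems" by (intro exI[of _ x] exI[of _ y]) simp
  qed
qed simp_all

text \<open>The neighbours of the \<open>k\<close>-th vertex are among the vertices \<open>k - 1\<close> and \<open>k + 1\<close>.\<close>

lemma path_no_branch:
  assumes "is_path G" "{q, a} \<in> edges G" "{q, b} \<in> edges G" "{q, c} \<in> edges G"
  shows "\<not> distinct [a, b, c]"
proof -
  obtain xs where xs: "distinct xs" "edges G = steps xs"
    using assms(1) by (auto simp: is_path_def)
  have "q \<in> set xs"
    using assms(2) unfolding xs(2) steps_def by (auto simp: doubleton_eq_iff)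
  then obtain k where k: "k < length xs" "q = xs ! k"
    by (auto simp: in_set_conv_nth)
  have "x = xs ! (k - 1) \<or> x = xs ! Suc k" if x: "{q, x} \<in> edges G" for x
  proof -
    obtain i where i: "Suc i < length xs" "{q, x} = {xs ! i, xs ! Suc i}"
      using x unfolding xs(2) steps_def by blast
    then consider "q = xs ! i" "x = xs ! Suc i" | "q = xs ! Suc i" "x = xs ! i"
      by (auto simp: doubleton_eq_iff)
    then show ?thesis
      using i(1) k xs(1) by cases (auto simp: nth_eq_iff_index_eq)
  qed
  from this[OF assms(2)] this[OF assms(3)] this[OF assms(4)] show ?thesis
    by auto
qed

lemma cycle_two_neighbours:
  assumes "3 \<le> length cs" "distinct cs" "steps cs \<subseteq> E" "{last cs, hd cs} \<in> E" "v \<in> set cs"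
  obtains u w where "u \<in> set cs" "w \<in> set cs" "u \<noteq> w" "u \<noteq> v" "w \<noteq> v" "{v, u} \<in> E" "{v, w} \<in> E"
proof -
  let ?n = "length cs"
  obtain k where k: "k < ?n" "v = cs ! k"
    using assms(5) by (auto simp: in_set_conv_nth)
  have step: "{cs ! i, cs ! Suc i} \<in> E" if "Suc i < ?n" for i
    using assms(3) that unfolding steps_def by blast
  have "cs \<noteq> []"
    using assms(1) by auto
  then have wrap: "{cs ! (?n - 1), cs ! 0} \<in> E"
    using assms(4) by (simp add: last_conv_nth hd_conv_nth)
  define i where "i = (if k = 0 then ?n - 1 else k - 1)"
  define j where "j = (if k = ?n - 1 then 0 else Suc k)"
  have bounds: "i < ?n" "j < ?n" "i \<noteq> j" "i \<noteq> k" "j \<noteq> k"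
    using k(1) assms(1) by (auto simp: i_def j_def)
  have "{cs ! k, cs ! i} \<in> E"
    using step[of "k - 1"] wrap k(1) by (cases "k = 0") (auto simp: i_def insert_commute)
  moreover have "{cs ! k, cs ! j} \<in> E"
    using step[of k] wrap k(1) by (cases "k = ?n - 1") (auto simp: j_def)
  ultimately show thesis
    using bounds k assms(2) by (intro that[of "cs ! i" "cs ! j"]) (auto simp: nth_eq_iff_index_eq)
qed

text \<open>Any further edge would close a segment of the Hamiltonian path to a cycle.\<close>

lemma tree_with_hamiltonian_path_is_path:
  assumes "is_tree T" "xs \<noteq> []" "distinct xs" "set xs = verts T" "steps xs \<subseteq> edges T"
  shows "is_path T"
proof -
  have "e \<in> steps xs" if e: "e \<in> edges T" for e
  proof (rule ccontr)
    assume new: "e \<notin> steps xs"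
    obtain x y where xy: "e = {x, y}" "x \<in> verts T" "y \<in> verts T" "x \<noteq> y"
      using assms(1) e unfolding is_tree_def simple_graph_def by blast
    obtain i' j' where "i' < length xs" "j' < length xs" "x = xs ! i'" "y = xs ! j'"
      using xy(2,3) assms(4) by (metis in_set_conv_nth)
    then obtain i j where ij: "i < j" "j < length xs" "e = {xs ! i, xs ! j}"
      using xy(1,4) by (metis insert_commute linorder_neqE_nat)
    have "Suc i \<noteq> j"
      using new ij unfolding steps_def by blast
    define cs where "cs = take (Suc j - i) (drop i xs)"
    have len: "length cs = Suc j - i"
      using ij by (simp add: cs_def)
    then have "3 \<le> length cs" "cs \<noteq> []"
      using ij \<open>Suc i \<noteq> j\<close> by auto
    moreover have "hd cs = xs ! i" "last cs = xs ! j"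
      using ij len \<open>cs \<noteq> []\<close> by (simp_all add: cs_def hd_conv_nth last_conv_nth)
    moreover have "distinct cs"
      using assms(3) by (simp add: cs_def)
    moreover have "set cs \<subseteq> verts T"
      unfolding cs_def assms(4)[symmetric] by (meson order_trans set_drop_subset set_take_subset)
    moreover have "steps cs \<subseteq> edges T"
      using steps_segment[of "Suc j - i" i xs] assms(5) by (simp add: cs_def)
    ultimately have "has_cycle T"
      unfolding has_cycle_def using e ij(3) by (intro exI[of _ cs]) (auto simp: insert_commute)
    then show False
      using assms(1) by (simp add: is_tree_def)
  qed
  then show ?thesis
    unfolding is_path_def using assms by (intro exI[of _ xs]) auto
qed

text \<open>A longest path in the tree misses some vertex; by connectedness, an edge leads from the path to
  a missed vertex, and by maximality it starts at an inner vertex of the path.\<close>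

lemma non_path_tree_has_branch:
  assumes "is_tree T" "finite (verts T)" "\<not> is_path T"
  obtains q a b c where "distinct [q, a, b, c]" "{q, a, b, c} \<subseteq> verts T"
    "{q, a} \<in> edges T" "{q, b} \<in> edges T" "{q, c} \<in> edges T"
proof -
  define P where "P = {xs. xs \<noteq> [] \<and> distinct xs \<and> set xs \<subseteq> verts T \<and> steps xs \<subseteq> edges T}"
  have conn: "connected_graph T"
    using assms(1) by (simp add: is_tree_def)
  then obtain r where "r \<in> verts T"
    unfolding connected_graph_def by blast
  then have "[r] \<in> P"
    by (simp add: P_def)
  have "length xs \<le> card (verts T)" if "xs \<in> P" for xs
    using that card_mono[OF assms(2), of "set xs"] by (simp add: P_def distinct_card)
  then obtain xs where xs: "xs \<in> P" and longest: "\<And>ys. ys \<in> P \<Longrightarrow> length ys \<le> length xs"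
    using ex_has_greatest_nat[of "\<lambda>xs. xs \<in> P" "[r]" length "Suc (card (verts T))"] \<open>[r] \<in> P\<close>
    by (auto simp: less_Suc_eq_le)
  have "set xs \<noteq> verts T"
    using tree_with_hamiltonian_path_is_path[OF assms(1)] assms(3) xs by (auto simp: P_def)
  then obtain t where t: "t \<in> verts T" "t \<notin> set xs"
    using xs by (auto simp: P_def)
  moreover have "hd xs \<in> verts T" "hd xs \<in> set xs"
    using xs by (auto simp: P_def)
  ultimately obtain ws where ws: "ws \<noteq> []" "set ws \<subseteq> verts T" "steps ws \<subseteq> edges T"
      "hd ws \<in> set xs" "last ws \<notin> set xs"
    using conn unfolding connected_graph_def by metis
  obtain u v where uv: "u \<in> set xs" "v \<notin> set xs" "v \<in> verts T" "{u, v} \<in> edges T"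
    using walk_crosses_boundary[OF ws(1,4,5)] ws(2,3) by blast
  obtain k where k: "k < length xs" "u = xs ! k"
    using uv(1) by (auto simp: in_set_conv_nth)
  have "xs \<noteq> []"
    using xs by (simp add: P_def)
  have "k \<noteq> 0"
  proof
    assume "k = 0"
    then have "v # xs \<in> P"
      using xs uv k by (cases xs) (auto simp: P_def insert_commute)
    then show False
      using longest[of "v # xs"] by simp
  qed
  moreover have "k \<noteq> length xs - 1"
  proof
    assume "k = length xs - 1"
    then have "xs @ [v] \<in> P"
      using xs uv k by (auto simp: P_def steps_append_single last_conv_nth)
    then show False
      using longest[of "xs @ [v]"] by simp
  qed
  ultimately have inner: "0 < k" "Suc k < length xs"
    using k(1) by auto
  have step: "{xs ! i, xs ! Suc i} \<in> edges T" if "Suc i < length xs" for i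
    using xs that unfolding P_def steps_def by blast
  have "distinct xs" "set xs \<subseteq> verts T"
    using xs by (auto simp: P_def)
  then show thesis
    using inner uv k step[of k] step[of "k - 1"]
    by (intro that[of u "xs ! (k - 1)" "xs ! Suc k" v])
       (auto simp: nth_eq_iff_index_eq insert_commute subset_iff dest: nth_mem)
qed

section \<open>Trees given by parent functions\<close>

text \<open>Every tree built below is of this form: the vertices are listed so that each one except the first
  is joined to a single earlier vertex, its parent. With the predecessor as parent this is a path, and
  exchanging an edge means changing one value of the parent function.\<close>

definition parent_tree :: "'v list \<Rightarrow> (nat \<Rightarrow> nat) \<Rightarrow> 'v ugraph" where
  "parent_tree xs p =
     \<lparr>verts = set xs, edges = (\<lambda>i. {xs ! i, xs ! p i}) ` {0<..<length xs}\<rparr>"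

lemma verts_parent_tree [simp]: "verts (parent_tree xs p) = set xs"
  by (simp add: parent_tree_def)

lemma edges_parent_tree: "edges (parent_tree xs p) = (\<lambda>i. {xs ! i, xs ! p i}) ` {0<..<length xs}"
  by (simp add: parent_tree_def)

locale parent_function =
  fixes xs :: "'v list" and p :: "nat \<Rightarrow> nat"
  assumes nonempty: "xs \<noteq> []" and dist: "distinct xs"
    and parent_less: "\<And>i. 0 < i \<Longrightarrow> i < length xs \<Longrightarrow> p i < i"
begin

lemma edge_to_smaller:
  assumes "b < a" "a < length xs" "{xs ! a, xs ! b} \<in> edges (parent_tree xs p)"
  shows "b = p a"
proof -
  obtain i where i: "0 < i" "i < length xs" "{xs ! a, xs ! b} = {xs ! i, xs ! p i}"
    using assms(3) by (auto simp: edges_parent_tree)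
  have "p i < i"
    using parent_less i by blast
  then show ?thesis
    using i assms dist by (auto simp: doubleton_eq_iff nth_eq_iff_index_eq)
qed

lemma connected_parent_tree: "connected_graph (parent_tree xs p)"
proof -
  let ?T = "parent_tree xs p"
  let ?R = "{(x, y). x \<in> verts ?T \<and> y \<in> verts ?T \<and> {x, y} \<in> edges ?T}"
  have "sym ?R"
    by (rule symI) (simp add: insert_commute)
  have down: "(xs ! i, xs ! 0) \<in> ?R\<^sup>*" if "i < length xs" for i
    using that
  proof (induction i rule: less_induct)
    case (less i)
    show ?case
    proof (cases "i = 0")
      case False
      then have "p i < i"
        using parent_less less.prems by simp
      then have "(xs ! p i, xs ! 0) \<in> ?R\<^sup>*"
        using less.IH less.prems by simp
      moreover have "{xs ! i, xs ! p i} \<in> edges ?T"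
        unfolding edges_parent_tree using False less.prems by (intro imageI) simp
      then have "(xs ! i, xs ! p i) \<in> ?R"
        using \<open>p i < i\<close> less.prems by simp
      ultimately show ?thesis
        by (rule converse_rtrancl_into_rtrancl[rotated])
    qed simp
  qed
  have reach: "(u, v) \<in> ?R\<^sup>*" if "u \<in> verts ?T" "v \<in> verts ?T" for u v
  proof -
    have "(u, xs ! 0) \<in> ?R\<^sup>*" "(v, xs ! 0) \<in> ?R\<^sup>*"
      using that down by (auto simp: in_set_conv_nth)
    then show ?thesis
      using sym_rtrancl[OF \<open>sym ?R\<close>] by (meson rtrancl_trans symD)
  qed
  show ?thesis
    unfolding connected_graph_def
  proof (intro conjI ballI)
    show "verts ?T \<noteq> {}"
      using nonempty by simp
  qed (rule walk_of_rtrancl[OF reach])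
qed

text \<open>On a cycle, the vertex of largest index would have two neighbours of smaller index, but only its
  parent qualifies.\<close>

lemma acyclic_parent_tree: "\<not> has_cycle (parent_tree xs p)"
proof
  assume "has_cycle (parent_tree xs p)"
  then obtain cs where cs: "3 \<le> length cs" "distinct cs" "steps cs \<subseteq> edges (parent_tree xs p)"
      "{last cs, hd cs} \<in> edges (parent_tree xs p)" "set cs \<subseteq> set xs"
    unfolding has_cycle_def by auto
  define I where "I = {i. i < length xs \<and> xs ! i \<in> set cs}"
  have "finite I"
    by (simp add: I_def)
  have "hd cs \<in> set cs"
    using cs(1) by (cases cs) auto
  then obtain i where "i < length xs" "xs ! i = hd cs"
    using cs(5) in_set_conv_nth[of "hd cs" xs] by blast
  then have "I \<noteq> {}"
    using \<open>hd cs \<in> set cs\<close> by (auto simp: I_def)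
  define m where "m = Max I"
  have m: "m < length xs" "xs ! m \<in> set cs"
    using Max_in[OF \<open>finite I\<close> \<open>I \<noteq> {}\<close>] by (simp_all add: m_def I_def)
  have parent: "u = xs ! p m"
    if "u \<in> set cs" "u \<noteq> xs ! m" "{xs ! m, u} \<in> edges (parent_tree xs p)" for u
  proof -
    have "u \<in> set xs"
      using that(1) cs(5) by blast
    then obtain b where b: "b < length xs" "u = xs ! b"
      by (auto simp: in_set_conv_nth)
    then have "b \<in> I"
      using that(1) by (simp add: I_def)
    then have "b \<le> m"
      unfolding m_def by (rule Max_ge[OF \<open>finite I\<close>])
    moreover have "b \<noteq> m"
      using that(2) b(2) by blast
    ultimately have "b < m"
      by simp
    then show ?thesis
      using edge_to_smaller[of b m] m b that by simp
  qed
  obtain u w where "u \<in> set cs" "w \<in> set cs" "u \<noteq> w" "u \<noteq> xs ! m" "w \<noteq> xs ! m"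
      "{xs ! m, u} \<in> edges (parent_tree xs p)" "{xs ! m, w} \<in> edges (parent_tree xs p)"
    using cycle_two_neighbours[OF cs(1-4) m(2)] by blast
  then show False
    using parent by blast
qed

lemma spanning_tree_parent_tree:
  "spanning_tree (complete_graph (set xs)) (parent_tree xs p)"
proof -
  have edge: "{xs ! i, xs ! p i} \<in> {{x, y} |x y. x \<in> set xs \<and> y \<in> set xs \<and> x \<noteq> y}"
    if "0 < i" "i < length xs" for i
  proof -
    have "p i < i"
      using parent_less that by blast
    then have "xs ! i \<in> set xs" "xs ! p i \<in> set xs" "xs ! i \<noteq> xs ! p i"
      using that dist by (auto simp: nth_eq_iff_index_eq)
    then show ?thesis
      by blast
  qed
  have "edges (parent_tree xs p) \<subseteq> {{x, y} |x y. x \<in> set xs \<and> y \<in> set xs \<and> x \<noteq> y}"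
    unfolding edges_parent_tree by (rule image_subsetI, rule edge) auto
  then show ?thesis
    using connected_parent_tree acyclic_parent_tree
    by (simp add: spanning_tree_def is_tree_def simple_graph_def complete_graph_def)
qed

end

lemma (in Metric_space) total_weight_parent_tree:
  assumes "parent_function xs p"
  shows "total_weight d (parent_tree xs p) = (\<Sum>i\<in>{0<..<length xs}. d (xs ! i) (xs ! p i))"
proof -
  interpret parent_function xs p by fact
  have "inj_on (\<lambda>i. {xs ! i, xs ! p i}) {0<..<length xs}"
  proof (rule inj_onI)
    fix i j assume ij: "i \<in> {0<..<length xs}" "j \<in> {0<..<length xs}"
      "{xs ! i, xs ! p i} = {xs ! j, xs ! p j}"
    then have "p i < i" "p j < j"
      using parent_less by auto
    then show "i = j"
      using ij dist by (auto simp: doubleton_eq_iff nth_eq_iff_index_eq)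
  qed
  moreover have "edge_weight d {xs ! i, xs ! p i} = d (xs ! i) (xs ! p i)"
    if "i \<in> {0<..<length xs}" for i
  proof -
    have "p i < i"
      using parent_less that by auto
    then show ?thesis
      using that dist by (intro edge_weight_doubleton) (auto simp: nth_eq_iff_index_eq)
  qed
  ultimately show ?thesis
    by (simp add: total_weight_def edges_parent_tree sum.reindex)
qed

lemma steps_eq_parent_tree: "steps xs = edges (parent_tree xs (\<lambda>i. i - 1))"
proof (intro equalityI subsetI)
  fix e assume "e \<in> steps xs"
  then obtain k where "Suc k < length xs" "e = {xs ! k, xs ! Suc k}"
    unfolding steps_def by blast
  then show "e \<in> edges (parent_tree xs (\<lambda>i. i - 1))"
    unfolding edges_parent_tree by (intro image_eqI[of _ _ "Suc k"]) (auto simp: insert_commute)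
next
  fix e assume "e \<in> edges (parent_tree xs (\<lambda>i. i - 1))"
  then obtain i where "0 < i" "i < length xs" "e = {xs ! i, xs ! (i - 1)}"
    unfolding edges_parent_tree by auto
  then show "e \<in> steps xs"
    unfolding steps_def by (intro CollectI exI[of _ "i - 1"]) (auto simp: insert_commute)
qed

section \<open>Paths as minimum spanning trees\<close>

lemma minimum_spanning_tree_exists:
  assumes "finite X" "X \<noteq> {}"
  obtains T where "minimum_spanning_tree X d T"
proof -
  let ?S = "{T. spanning_tree (complete_graph X) T}"
  obtain xs where xs: "set xs = X" "distinct xs"
    using finite_distinct_list[OF assms(1)] by blast
  then have "parent_function xs (\<lambda>i. i - 1)"
    using assms(2) by unfold_locales auto
  then have "?S \<noteq> {}"
    using parent_function.spanning_tree_parent_tree xs(1) by blast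
  moreover have "finite ?S"
  proof (rule finite_subset)
    show "?S \<subseteq> (\<lambda>E. \<lparr>verts = X, edges = E\<rparr>) ` Pow (edges (complete_graph X))"
    proof
      fix T assume "T \<in> ?S"
      then have "verts T = X" "edges T \<subseteq> edges (complete_graph X)"
        by (auto simp: spanning_tree_def complete_graph_def)
      then show "T \<in> (\<lambda>E. \<lparr>verts = X, edges = E\<rparr>) ` Pow (edges (complete_graph X))"
        by (intro image_eqI[of _ _ "edges T"]) auto
    qed
    have "edges (complete_graph X) \<subseteq> Pow X"
      by (auto simp: complete_graph_def)
    then show "finite ((\<lambda>E. \<lparr>verts = X, edges = E\<rparr>) ` Pow (edges (complete_graph X)))"
      using assms(1) by (meson finite_Pow_iff finite_imageI finite_subset)
  qed
  ultimately obtain T where "T \<in> ?S" "\<And>S. S \<in> ?S \<Longrightarrow> total_weight d T \<le> total_weight d S"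
    using arg_min_if_finite(1)[of ?S "total_weight d"] arg_min_least[of ?S _ "total_weight d"] by blast
  then show thesis
    by (intro that[of T]) (simp add: minimum_spanning_tree_def)
qed

lemma path_eq_parent_tree:
  fixes T :: "'v ugraph"
  assumes "is_path T"
  obtains xs where "xs \<noteq> []" "distinct xs" "verts T = set xs" "T = parent_tree xs (\<lambda>i. i - 1)"
proof -
  obtain xs where xs: "xs \<noteq> []" "distinct xs" "verts T = set xs" "edges T = steps xs"
    using assms unfolding is_path_def by blast
  then have "T = parent_tree xs (\<lambda>i. i - 1)"
    unfolding steps_eq_parent_tree by (intro ugraph.equality) simp_all
  then show thesis
    using that xs by blast
qed

lemma parent_tree_rev: "parent_tree (rev xs) (\<lambda>i. i - 1) = parent_tree xs (\<lambda>i. i - 1)"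
proof (rule ugraph.equality)
  show "edges (parent_tree (rev xs) (\<lambda>i. i - 1)) = edges (parent_tree xs (\<lambda>i. i - 1))"
    unfolding steps_eq_parent_tree[symmetric] by (rule steps_rev)
qed simp_all

context ultrametric_space
begin

definition two_close_pairs :: bool where
  "two_close_pairs \<longleftrightarrow>
     (\<exists>a b c e. distinct [a, b, c, e] \<and> M = {a, b, c, e} \<and> d a b < d b c \<and> d c e < d b c)"

lemma isosceles:
  assumes "x \<in> M" "y \<in> M" "z \<in> M" "d x y < d y z"
  shows "d x z = d y z"
  using ultrametric[of x z y] ultrametric[of y z x] assms by (auto simp: commute)

text \<open>Otherwise exchanging one edge gives a minimum spanning tree with a branch at \<open>xs ! (j - 2)\<close>. The
  bound \<open>3 \<le> j\<close> makes sure that this vertex already has the neighbour \<open>xs ! (j - 3)\<close>.\<close>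

lemma weights_decrease_along_path:
  assumes "\<forall>T. minimum_spanning_tree M d T \<longrightarrow> is_path T"
    and mst: "minimum_spanning_tree M d (parent_tree xs (\<lambda>i. i - 1))"
    and xs: "distinct xs" "set xs = M" and j: "3 \<le> j" "j < length xs"
  shows "d (xs ! (j - 1)) (xs ! j) < d (xs ! (j - 2)) (xs ! (j - 1))"
proof (rule ccontr)
  assume "\<not> ?thesis"
  then have heavy: "d (xs ! (j - 2)) (xs ! (j - 1)) \<le> d (xs ! (j - 1)) (xs ! j)"
    by simp
  \<comment> \<open>Move the edge that ends in \<open>xs ! j\<close> one vertex back.\<close>
  define p where "p = (\<lambda>i::nat. i - 1)(j := j - 2)"
  interpret old: parent_function xs "\<lambda>i. i - 1"
    using xs(1) j by unfold_locales auto
  interpret new: parent_function xs p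
    using xs(1) j by unfold_locales (auto simp: p_def)
  have in_M: "xs ! i \<in> M" if "i < length xs" for i
    using that xs(2) nth_mem by blast
  have "d (xs ! i) (xs ! p i) \<le> d (xs ! i) (xs ! (i - 1))" if "i \<in> {0<..<length xs}" for i
  proof (cases "i = j")
    case True
    have "d (xs ! j) (xs ! (j - 2)) \<le> max (d (xs ! j) (xs ! (j - 1))) (d (xs ! (j - 1)) (xs ! (j - 2)))"
      by (rule ultrametric) (use j in_M in auto)
    then show ?thesis
      using heavy True by (simp add: p_def commute)
  qed (simp add: p_def)
  then have "total_weight d (parent_tree xs p) \<le> total_weight d (parent_tree xs (\<lambda>i. i - 1))"
    unfolding total_weight_parent_tree[OF new.parent_function_axioms]
      total_weight_parent_tree[OF old.parent_function_axioms]
    by (rule sum_mono)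
  then have "minimum_spanning_tree M d (parent_tree xs p)"
    using mst new.spanning_tree_parent_tree xs(2) unfolding minimum_spanning_tree_def
    by (meson order_trans)
  then have path: "is_path (parent_tree xs p)"
    using assms(1) by blast
  have edge: "{xs ! i, xs ! p i} \<in> edges (parent_tree xs p)" if "0 < i" "i < length xs" for i
    unfolding edges_parent_tree using that by (intro imageI) simp
  have p: "p (j - 2) = j - 3" "p (j - 1) = j - 2" "p j = j - 2"
    using j by (auto simp: p_def)
  have "{xs ! (j - 2), xs ! (j - 3)} \<in> edges (parent_tree xs p)"
    using edge[of "j - 2"] j p by simp
  moreover have "{xs ! (j - 2), xs ! (j - 1)} \<in> edges (parent_tree xs p)"
    using edge[of "j - 1"] j p by (simp add: insert_commute)
  moreover have "{xs ! (j - 2), xs ! j} \<in> edges (parent_tree xs p)"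
    using edge[of j] j p by (simp add: insert_commute)
  moreover have "distinct [xs ! (j - 3), xs ! (j - 1), xs ! j]"
    using j xs(1) by (auto simp: nth_eq_iff_index_eq)
  ultimately show False
    using path_no_branch[OF path] by blast
qed

lemma two_close_pairs_if_all_paths:
  assumes "finite M" "M \<noteq> {}" and paths: "\<forall>T. minimum_spanning_tree M d T \<longrightarrow> is_path T"
    and "3 < card M"
  shows two_close_pairs
proof -
  obtain T where T: "minimum_spanning_tree M d T"
    using minimum_spanning_tree_exists[OF assms(1,2)] .
  then obtain xs where xs: "distinct xs" "verts T = set xs" "T = parent_tree xs (\<lambda>i. i - 1)"
    using paths path_eq_parent_tree by metis
  have M: "set xs = M"
    using T xs(2) by (simp add: minimum_spanning_tree_def spanning_tree_def complete_graph_def)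
  have len: "3 < length xs"
    using assms(4) distinct_card[OF xs(1)] M by simp
  have decrease: "d (xs ! (j - 1)) (xs ! j) < d (xs ! (j - 2)) (xs ! (j - 1))"
    if "3 \<le> j" "j < length xs" for j
    using weights_decrease_along_path[OF paths _ xs(1) M that] T xs(3) by simp
  have "minimum_spanning_tree M d (parent_tree (rev xs) (\<lambda>i. i - 1))"
    unfolding parent_tree_rev using T xs(3) by simp
  then have decrease_rev: "d (rev xs ! (j - 1)) (rev xs ! j) < d (rev xs ! (j - 2)) (rev xs ! (j - 1))"
    if "3 \<le> j" "j < length xs" for j
    using weights_decrease_along_path[OF paths, of "rev xs" j] that xs(1) M by simp
  \<comment> \<open>The reversed list, with indices counted from the front again.\<close>
  have increase: "d (xs ! i) (xs ! Suc i) < d (xs ! Suc i) (xs ! Suc (Suc i))"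
    if "Suc (Suc (Suc i)) < length xs" for i
    using decrease_rev[of "length xs - Suc i"] that
    by (simp add: rev_nth commute Suc_diff_Suc numeral_eq_Suc)
  have right: "d (xs ! 2) (xs ! 3) < d (xs ! 1) (xs ! 2)"
    using decrease[of 3] len by simp
  have left: "d (xs ! 0) (xs ! 1) < d (xs ! 1) (xs ! 2)"
    using increase[of 0] len by (simp add: numeral_eq_Suc)
  \<comment> \<open>With a fifth vertex, \<open>increase\<close> also applies to the second edge and contradicts \<open>right\<close>.\<close>
  have "\<not> 4 < length xs"
    using increase[of 1] right by (auto simp: numeral_eq_Suc)
  with len have "length xs = 4"
    by simp
  then obtain a b c e where "xs = [a, b, c, e]"
    by (auto simp: numeral_eq_Suc length_Suc_conv)
  then show ?thesis
    using xs(1) M left right unfolding two_close_pairs_def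
    by (intro exI[of _ a] exI[of _ b] exI[of _ c] exI[of _ e]) simp
qed

text \<open>The path \<open>x, q, y, z\<close> has the edge \<open>{y, z}\<close> in place of the longer \<open>{q, z}\<close>.\<close>

lemma star_not_minimal:
  assumes "distinct [q, x, y, z]" "M = {q, x, y, z}" "d y z < d q z"
    and star: "{q, x} \<in> edges T" "{q, y} \<in> edges T" "{q, z} \<in> edges T"
  shows "\<not> minimum_spanning_tree M d T"
proof
  assume T: "minimum_spanning_tree M d T"
  have fin: "finite (edges T)"
  proof (rule finite_subset)
    show "edges T \<subseteq> Pow M"
      using T by (auto simp: minimum_spanning_tree_def spanning_tree_def complete_graph_def)
  qed (use assms(2) in simp)
  have nonneg: "0 \<le> edge_weight d e" if "e \<in> edges T" for e
  proof -
    have "e \<in> {{u, v} | u v. u \<in> M \<and> v \<in> M \<and> u \<noteq> v}"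
      using T that by (auto simp: minimum_spanning_tree_def spanning_tree_def complete_graph_def)
    then show ?thesis
      by (auto simp: edge_weight_doubleton)
  qed
  have "d q x + d q y + d q z = (\<Sum>e\<in>{{q, x}, {q, y}, {q, z}}. edge_weight d e)"
    using assms(1) by (simp add: edge_weight_doubleton doubleton_eq_iff)
  also have "\<dots> \<le> total_weight d T"
    unfolding total_weight_def by (rule sum_mono2) (use fin star nonneg in auto)
  finally have star_weight: "d q x + d q y + d q z \<le> total_weight d T" .
  let ?P = "parent_tree [x, q, y, z] (\<lambda>i. i - 1)"
  interpret parent_function "[x, q, y, z]" "\<lambda>i. i - 1"
    using assms(1) by unfold_locales auto
  have "{0<..<length [x, q, y, z]} = {1, 2, 3}"
    by auto
  then have "total_weight d ?P = d q x + d y q + d z y"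
    unfolding total_weight_parent_tree[OF parent_function_axioms] by (simp add: numeral_eq_Suc)
  moreover have "set [x, q, y, z] = M"
    using assms(2) by auto
  then have "total_weight d T \<le> total_weight d ?P"
    using T spanning_tree_parent_tree by (simp add: minimum_spanning_tree_def)
  ultimately show False
    using star_weight assms(3) by (simp add: commute)
qed

lemma all_paths_if_few_points_or_two_close_pairs:
  assumes "finite M"
    and "card M \<le> 3 \<or> two_close_pairs"
    and T: "minimum_spanning_tree M d T"
  shows "is_path T"
proof (rule ccontr)
  assume "\<not> is_path T"
  have verts: "verts T = M" "is_tree T"
    using T by (auto simp: minimum_spanning_tree_def spanning_tree_def complete_graph_def)
  then obtain q x y z where q: "distinct [q, x, y, z]" "{q, x, y, z} \<subseteq> M"
      "{q, x} \<in> edges T" "{q, y} \<in> edges T" "{q, z} \<in> edges T"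
    using non_path_tree_has_branch[of T] \<open>\<not> is_path T\<close> assms(1) by metis
  have "card {q, x, y, z} = 4"
    using q(1) by simp
  moreover have "card {q, x, y, z} \<le> card M"
    using assms(1) q(2) by (rule card_mono)
  ultimately obtain a b c e where abce: "distinct [a, b, c, e]" "M = {a, b, c, e}"
      "d a b < d b c" "d c e < d b c"
    using assms(2) unfolding two_close_pairs_def by auto
  then have "card M = 4"
    by simp
  then have "M = {q, x, y, z}"
    using card_subset_eq[OF assms(1) q(2)] \<open>card {q, x, y, z} = 4\<close> by simp
  \<comment> \<open>The tree contains the star with centre \<open>q\<close>; the pair without \<open>q\<close> then gives a shorter edge.\<close>
  then have adj: "{q, v} \<in> edges T" if "v \<in> M" "v \<noteq> q" for v
    using that q by auto
  have "d a c = d b c"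
    using isosceles[of a b c] abce by auto
  moreover have "d b e = d b c"
    using isosceles[of e c b] abce by (auto simp: commute)
  moreover have "d a e = d b c"
    using isosceles[of e c a] abce \<open>d a c = d b c\<close> by (auto simp: commute)
  ultimately have far: "d a c = d b c" "d b e = d b c" "d a e = d b c"
    by auto
  have M_perm: "M = {b, a, c, e}" "M = {c, e, a, b}" "M = {e, c, a, b}"
    using abce(2) by auto
  have "q \<in> {a, b, c, e}"
    using q(2) abce(2) by auto
  then consider "q = a" | "q = b" | "q = c" | "q = e"
    by auto
  then show False
  proof cases
    case 1
    then show ?thesis
      using star_not_minimal[of a b c e T] T adj abce far by auto
  next
    case 2
    then show ?thesis
      using star_not_minimal[of b a c e T, OF _ M_perm(1)] T adj abce far by auto
  next
    case 3
    then show ?thesis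
      using star_not_minimal[of c e a b T, OF _ M_perm(2)] T adj abce far by (auto simp: commute)
  next
    case 4
    then show ?thesis
      using star_not_minimal[of e c a b T, OF _ M_perm(3)] T adj abce far by (auto simp: commute)
  qed
qed

end

section \<open>The recursive structure of representing trees\<close>

lemma rep_nodes_leaf:
  assumes "\<not> 0 < diam d A"
  shows "rep_nodes A d = {A}"
proof -
  have "B = A" if "B \<in> rep_nodes A d" for B
    using that by induction (use assms in auto)
  then show ?thesis
    using rep_nodes.root by blast
qed

lemma rep_nodes_rec:
  assumes "0 < diam d A"
  shows "rep_nodes A d = insert A (\<Union>C\<in>parts (diametrical_graph d A). rep_nodes C d)"
proof (intro equalityI subsetI)
  fix B assume "B \<in> rep_nodes A d"
  then show "B \<in> insert A (\<Union>C\<in>parts (diametrical_graph d A). rep_nodes C d)"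
  proof induction
    case (child B C)
    then consider "B = A" | E where "E \<in> parts (diametrical_graph d A)" "B \<in> rep_nodes E d"
      by blast
    then show ?case
    proof cases
      case 1
      then show ?thesis
        using child.hyps(3) rep_nodes.root by blast
    next
      case 2
      then show ?thesis
        using rep_nodes.child[OF 2(2) child.hyps(2,3)] by blast
    qed
  qed simp
next
  fix B assume "B \<in> insert A (\<Union>C\<in>parts (diametrical_graph d A). rep_nodes C d)"
  moreover have "B \<in> rep_nodes A d"
    if "C \<in> parts (diametrical_graph d A)" "B \<in> rep_nodes C d" for C
    using that(2)
  proof induction
    case root
    show ?case
      by (rule rep_nodes.child[OF rep_nodes.root assms that(1)])
  qed (rule rep_nodes.child)
  ultimately show "B \<in> rep_nodes A d"
    using rep_nodes.root by blast
qed

lemma verts_representing_tree [simp]: "verts (representing_tree A d) = rep_nodes A d"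
  by (simp add: representing_tree_def)

lemma root_of_representing_tree [simp]: "root_of (representing_tree A d) = A"
  by (simp add: representing_tree_def)

lemma edges_representing_tree:
  "edges (representing_tree A d) =
     (\<Union>B\<in>{B \<in> rep_nodes A d. 0 < diam d B}. (\<lambda>C. {B, C}) ` parts (diametrical_graph d B))"
  by (auto simp: representing_tree_def)

lemma edges_representing_tree_leaf:
  "\<not> 0 < diam d A \<Longrightarrow> edges (representing_tree A d) = {}"
  by (auto simp: edges_representing_tree rep_nodes_leaf)

lemma edges_representing_tree_rec:
  assumes "0 < diam d A"
  shows "edges (representing_tree A d) =
     (\<lambda>C. {A, C}) ` parts (diametrical_graph d A) \<union>
     (\<Union>C\<in>parts (diametrical_graph d A). edges (representing_tree C d))"
  using assms unfolding edges_representing_tree rep_nodes_rec[OF assms] by blast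

text \<open>The nodes are listed in the numbering of the target, so the list is the inverse of the
  isomorphism. In this form the condition on edges is one equation between explicit sets.\<close>

lemma rooted_isoI:
  fixes ns :: "'v list"
  assumes "distinct ns" "verts G = set ns" "verts H = {..<length ns}" "0 < length ns"
    and "root_of G = ns ! 0" "root_of H = 0" "\<Union>(edges H) \<subseteq> verts H"
    and edges: "edges G = (\<lambda>e. (!) ns ` e) ` edges H"
  shows "rooted_iso G H"
proof -
  let ?f = "inv_into {..<length ns} ((!) ns)"
  have inj: "inj_on ((!) ns) {..<length ns}"
    using assms(1) by (simp add: inj_on_nth)
  have bij: "bij_betw ((!) ns) {..<length ns} (set ns)"
    using assms(1) by (intro bij_betw_nth) simp_all
  have index: "?f v \<in> {..<length ns}" "ns ! ?f v = v" if "v \<in> set ns" for v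
    using that inv_into_into[of v "(!) ns"] f_inv_into_f[of v "(!) ns"]
    unfolding bij_betw_imp_surj_on[OF bij, symmetric] by blast+
  have "{u, v} \<in> edges G \<longleftrightarrow> {?f u, ?f v} \<in> edges H" if uv: "u \<in> set ns" "v \<in> set ns" for u v
  proof -
    have "{u, v} = (!) ns ` {?f u, ?f v}"
      using index uv by simp
    moreover have "(!) ns ` {?f u, ?f v} = (!) ns ` e \<longleftrightarrow> {?f u, ?f v} = e" if "e \<in> edges H" for e
      using that index uv assms(3,7) by (intro inj_on_image_eq_iff[OF inj]) auto
    ultimately show ?thesis
      unfolding edges image_iff by metis
  qed
  moreover have "?f (ns ! 0) = 0"
    using inv_into_f_f[OF inj] assms(4) by simp
  ultimately show ?thesis
    unfolding rooted_iso_def using bij_betw_inv_into[OF bij] assms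
    by (intro exI[of _ ?f]) simp
qed

context ultrametric_space
begin

lemma diam_eqI:
  assumes "finite A" "x \<in> A" "y \<in> A" "\<And>u v. u \<in> A \<Longrightarrow> v \<in> A \<Longrightarrow> d u v \<le> d x y"
  shows "diam d A = d x y"
proof -
  have "A \<noteq> {}"
    using assms(2) by blast
  then obtain u v where "u \<in> A" "v \<in> A" "d u v = diam d A"
    using diam_attained[OF assms(1)] by metis
  then show ?thesis
    using assms(4)[of u v] diam_upper[OF assms(1-3)] by simp
qed

lemma parts_eq_image:
  assumes "finite A" "0 < diam d A" "A \<subseteq> M"
  shows "parts (diametrical_graph d A) = (\<lambda>u. {v \<in> A. d u v < diam d A}) ` A"
proof -
  have "{(u, v). u \<in> A \<and> v \<in> A \<and> d u v < diam d A} `` {u} = {v \<in> A. d u v < diam d A}"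
    if "u \<in> A" for u
    using that by auto
  then show ?thesis
    unfolding parts_diametrical_graph[OF assms] quotient_def by auto
qed

lemma same_part_iff:
  assumes "finite A" "0 < diam d A" "A \<subseteq> M" "B \<in> parts (diametrical_graph d A)"
    "C \<in> parts (diametrical_graph d A)" "u \<in> B" "v \<in> C"
  shows "B = C \<longleftrightarrow> d u v < diam d A"
proof -
  have "u \<in> A" "v \<in> A"
    using partition_onD1[OF diametrical_graph_parts(1)[OF assms(1-3)]] assms(4-7) by blast+
  then show ?thesis
    using quotient_eq_iff[OF equiv_less_diam[OF assms(1-3)]] assms(4-7)
    unfolding parts_diametrical_graph[OF assms(1-3)] by simp
qed

lemma card_le_1_if_no_diam:
  assumes "finite A" "A \<subseteq> M" "\<not> 0 < diam d A"
  shows "card A \<le> 1"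
proof -
  have "x = y" if "x \<in> A" "y \<in> A" for x y
  proof -
    have "d x y \<le> 0"
      using diam_upper[OF assms(1) that] assms(3) by simp
    then show ?thesis
      using that assms(2) nonneg[of x y] zero[of x y] by auto
  qed
  then show ?thesis
    using card_le_Suc0_iff_eq[OF assms(1)] by auto
qed

lemma not_diam_singleton: "x \<in> M \<Longrightarrow> \<not> 0 < diam d {x}"
  using diam_eqI[of "{x}" x x] by simp

lemma tree_singleton:
  assumes "x \<in> M"
  shows "rep_nodes {x} d = {{x}}" "edges (representing_tree {x} d) = {}"
  using not_diam_singleton[OF assms] by (simp_all add: rep_nodes_leaf edges_representing_tree_leaf)

lemma tree_pair:
  assumes "a \<in> M" "b \<in> M" "a \<noteq> b"
  shows "rep_nodes {a, b} d = {{a, b}, {a}, {b}}"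
    "edges (representing_tree {a, b} d) = {{{a, b}, {a}}, {{a, b}, {b}}}"
proof -
  have pos: "0 < d a b"
    using assms by simp
  have diam: "diam d {a, b} = d a b"
    by (rule diam_eqI) (use assms pos in \<open>auto simp: commute\<close>)
  have "parts (diametrical_graph d {a, b}) = (\<lambda>u. {v \<in> {a, b}. d u v < d a b}) ` {a, b}"
    using parts_eq_image[of "{a, b}"] assms diam pos by simp
  also have "\<dots> = {{a}, {b}}"
  proof -
    have "{v \<in> {a, b}. d a v < d a b} = {a}" "{v \<in> {a, b}. d b v < d a b} = {b}"
      using assms pos by (auto simp: commute)
    then show ?thesis by simp
  qed
  finally show "rep_nodes {a, b} d = {{a, b}, {a}, {b}}"
    "edges (representing_tree {a, b} d) = {{{a, b}, {a}}, {{a, b}, {b}}}"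
    using rep_nodes_rec[of d "{a, b}"] edges_representing_tree_rec[of d "{a, b}"]
    by (simp_all add: diam pos tree_singleton assms insert_commute)
qed

lemma iso_T4:
  assumes "M = {a, b, c}" "distinct [a, b, c]" "d a b = d b c" "d a c = d b c"
  shows "rooted_iso (representing_tree M d) T4"
proof -
  have pos: "0 < d b c" and in_M: "a \<in> M" "b \<in> M" "c \<in> M"
    using assms by simp_all
  have diam: "diam d M = d b c"
    by (rule diam_eqI) (use assms pos in \<open>auto simp: commute\<close>)
  have "{v \<in> M. d a v < d b c} = {a}" "{v \<in> M. d b v < d b c} = {b}" "{v \<in> M. d c v < d b c} = {c}"
    using assms pos in_M by (auto simp: commute)
  then have parts: "parts (diametrical_graph d M) = {{a}, {b}, {c}}"
    using parts_eq_image[of M] assms(1) diam pos by simp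
  have "0 < diam d M"
    using diam pos by simp
  note rec = rep_nodes_rec[OF this] edges_representing_tree_rec[OF this]
  have "rep_nodes M d = {M, {a}, {b}, {c}}"
      "edges (representing_tree M d) = {{M, {a}}, {M, {b}}, {M, {c}}}"
    unfolding rec parts by (simp_all add: tree_singleton in_M insert_commute)
  moreover have "distinct [M, {a}, {b}, {c}]"
    using assms(1,2) by auto
  moreover have "verts T4 = {..<length [M, {a}, {b}, {c}]}"
    by (simp add: T4_def) auto
  ultimately show ?thesis
    by (intro rooted_isoI[of "[M, {a}, {b}, {c}]"]) (simp_all add: T4_def)
qed

lemma iso_T2:
  assumes "M = {a, b, c}" "distinct [a, b, c]" "d b c < d a b" "d b c < d a c"
  shows "rooted_iso (representing_tree M d) T2"
proof -
  have in_M: "a \<in> M" "b \<in> M" "c \<in> M"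
    using assms by simp_all
  have pos: "0 < d a b"
    using assms in_M by simp
  have eq: "d a c = d a b"
    using isosceles[of c b a] assms in_M by (simp add: commute)
  have diam: "diam d M = d a b"
    by (rule diam_eqI) (use assms pos eq in \<open>auto simp: commute\<close>)
  have "{v \<in> M. d a v < d a b} = {a}" "{v \<in> M. d b v < d a b} = {b, c}"
      "{v \<in> M. d c v < d a b} = {b, c}"
    using assms pos in_M eq by (auto simp: commute)
  then have parts: "parts (diametrical_graph d M) = {{a}, {b, c}}"
    using parts_eq_image[of M] assms(1) diam pos by simp
  have "0 < diam d M"
    using diam pos by simp
  note rec = rep_nodes_rec[OF this] edges_representing_tree_rec[OF this]
  have "rep_nodes M d = {M, {a}, {b, c}, {b}, {c}}"
      "edges (representing_tree M d) = {{M, {a}}, {M, {b, c}}, {{b, c}, {b}}, {{b, c}, {c}}}"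
    using assms(2)
    unfolding rec parts by (simp_all add: tree_singleton tree_pair in_M insert_commute)
  moreover have "distinct [M, {a}, {b, c}, {b}, {c}]"
    using assms(1,2) by auto
  moreover have "verts T2 = {..<length [M, {a}, {b, c}, {b}, {c}]}"
    by (simp add: T2_def) auto
  ultimately show ?thesis
    by (intro rooted_isoI[of "[M, {a}, {b, c}, {b}, {c}]"]) (simp_all add: T2_def)
qed

text \<open>By \<open>isosceles\<close>, all four distances across the pairs equal \<open>d b c\<close>.\<close>

lemma iso_T1:
  assumes "M = {a, b, c, e}" "distinct [a, b, c, e]" "d a b < d b c" "d c e < d b c"
  shows "rooted_iso (representing_tree M d) T1"
proof -
  have in_M: "a \<in> M" "b \<in> M" "c \<in> M" "e \<in> M"
    using assms by simp_all
  have pos: "0 < d b c"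
    using assms in_M by simp
  have ac: "d a c = d b c"
    using isosceles[of a b c] assms in_M by simp
  have be: "d b e = d b c"
    using isosceles[of e c b] assms in_M by (simp add: commute)
  have ae: "d a e = d b c"
    using isosceles[of e c a] assms in_M ac by (simp add: commute)
  have table: "d a a = 0" "d b b = 0" "d c c = 0" "d e e = 0" "d a c = d b c" "d b e = d b c"
      "d a e = d b c" "d b a = d a b" "d c a = d b c" "d e a = d b c" "d c b = d b c"
      "d e b = d b c" "d e c = d c e"
    using in_M ac be ae by (simp_all add: commute)
  note close = assms(3,4)
  have diam: "diam d M = d b c"
  proof (rule diam_eqI)
    fix u v assume "u \<in> M" "v \<in> M"
    then have "u \<in> {a, b, c, e}" "v \<in> {a, b, c, e}"
      using assms(1) by simp_all
    then show "d u v \<le> d b c"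
      using close pos by (elim insertE) (simp_all add: table)
  qed (simp_all add: assms(1))
  have "{v \<in> M. d a v < d b c} = {a, b}" "{v \<in> M. d b v < d b c} = {a, b}"
      "{v \<in> M. d c v < d b c} = {c, e}" "{v \<in> M. d e v < d b c} = {c, e}"
    unfolding assms(1) using close pos by (auto simp: table)
  then have parts: "parts (diametrical_graph d M) = {{a, b}, {c, e}}"
    using parts_eq_image[of M] assms(1) diam pos by simp
  have "0 < diam d M"
    using diam pos by simp
  note rec = rep_nodes_rec[OF this] edges_representing_tree_rec[OF this]
  have "rep_nodes M d = {M, {a, b}, {c, e}, {a}, {b}, {c}, {e}}"
      "edges (representing_tree M d) = {{M, {a, b}}, {M, {c, e}}, {{a, b}, {a}}, {{a, b}, {b}},
         {{c, e}, {c}}, {{c, e}, {e}}}"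
    using assms(2)
    unfolding rec parts by (simp_all add: tree_pair in_M insert_commute)
  moreover have "distinct [M, {a, b}, {c, e}, {a}, {b}, {c}, {e}]"
    using assms(1,2) by auto
  moreover have "verts T1 = {..<length [M, {a, b}, {c, e}, {a}, {b}, {c}, {e}]}"
    by (simp add: T1_def) auto
  ultimately show ?thesis
    by (intro rooted_isoI[of "[M, {a, b}, {c, e}, {a}, {b}, {c}, {e}]"]) (simp_all add: T1_def)
qed

lemma iso_if_few_points_or_two_close_pairs:
  assumes "finite M" "M \<noteq> {}"
    and "card M \<le> 3 \<or> two_close_pairs"
  shows "\<exists>T' \<in> {T1, T2, T3, T4, T5}. rooted_iso (representing_tree M d) T'"
  using assms(3)
proof
  assume "card M \<le> 3"
  moreover have "card M \<noteq> 0"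
    using assms by simp
  ultimately consider "card M = 1" | "card M = 2" | "card M = 3"
    by linarith
  then show ?thesis
  proof cases
    case 1
    then obtain a where M: "M = {a}"
      by (auto simp: card_1_singleton_iff)
    have "rooted_iso (representing_tree M d) T5"
      by (rule rooted_isoI[of "[M]"]) (use tree_singleton[of a] M in \<open>auto simp: T5_def\<close>)
    then show ?thesis by simp
  next
    case 2
    then obtain a b where M: "M = {a, b}" "a \<noteq> b"
      by (auto simp: card_2_iff)
    have "distinct [M, {a}, {b}]" "verts T3 = {..<length [M, {a}, {b}]}"
      using M by (auto simp: T3_def)
    then have "rooted_iso (representing_tree M d) T3"
      by (intro rooted_isoI[of "[M, {a}, {b}]"]) (use tree_pair[of a b] M in \<open>simp_all add: T3_def\<close>)
    then show ?thesis by simp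
  next
    case 3
    then obtain a b c where M: "M = {a, b, c}" "distinct [a, b, c]"
      by (auto simp: card_3_iff)
    have in_M: "a \<in> M" "b \<in> M" "c \<in> M" and M_perm: "M = {b, a, c}" "M = {c, a, b}"
      using M by auto
    consider "d a b = d b c" "d a c = d b c" | "d b c < d a b" "d b c < d a c"
      | "d a c < d a b" "d a c < d b c" | "d a b < d a c" "d a b < d b c"
      using ultrametric[OF in_M(1,2,3)] ultrametric[OF in_M(1,3,2)] ultrametric[OF in_M(2,3,1)]
      by (smt (verit) commute)
    then show ?thesis
    proof cases
      case 1
      then show ?thesis
        using iso_T4[of a b c] M by simp
    next
      case 2
      then show ?thesis
        using iso_T2[of a b c] M by simp
    next
      case 3
      then show ?thesis
        using iso_T2[of b a c, OF M_perm(1)] M by (auto simp: commute)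
    next
      case 4
      then show ?thesis
        using iso_T2[of c a b, OF M_perm(2)] M by (auto simp: commute)
    qed
  qed
next
  assume two_close_pairs
  then show ?thesis
    unfolding two_close_pairs_def using iso_T1 by blast
qed

end

section \<open>Counting points through an isomorphism\<close>

text \<open>For an isomorphic copy of a representing tree, these vertices include the images of all children
  of the node at \<open>v\<close>. The image of a parent, unless it is the root, is among them too, which does no
  harm to bounds from above.\<close>

definition nonroot_neighbours :: "('w, 'c) rooted_graph_scheme \<Rightarrow> 'w \<Rightarrow> 'w set" where
  "nonroot_neighbours H v = {w \<in> verts H. {v, w} \<in> edges H \<and> w \<noteq> root_of H}"

text \<open>Rewriting rule that evaluates the following sets vertex by vertex.\<close>

lemma filter_insert:
  "{w \<in> insert a A. P w} = (if P a then insert a {w \<in> A. P w} else {w \<in> A. P w})"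
  by auto

lemma nonroot_neighbours_T1:
  "nonroot_neighbours T1 0 = {1, 2}"
  "nonroot_neighbours T1 1 = {3, 4}"
  "nonroot_neighbours T1 2 = {5, 6}"
  "nonroot_neighbours T1 3 = {1}"
  "nonroot_neighbours T1 4 = {1}"
  "nonroot_neighbours T1 5 = {2}"
  "nonroot_neighbours T1 6 = {2}"
  unfolding nonroot_neighbours_def T1_def ugraph.simps rooted_graph.simps filter_insert
  by (simp_all add: doubleton_eq_iff)

lemma nonroot_neighbours_T2:
  "nonroot_neighbours T2 0 = {1, 2}"
  "nonroot_neighbours T2 1 = {}"
  "nonroot_neighbours T2 2 = {3, 4}"
  "nonroot_neighbours T2 3 = {2}"
  "nonroot_neighbours T2 4 = {2}"
  unfolding nonroot_neighbours_def T2_def ugraph.simps rooted_graph.simps filter_insert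
  by (simp_all add: doubleton_eq_iff)

lemma nonroot_neighbours_T3:
  "nonroot_neighbours T3 0 = {1, 2}"
  "nonroot_neighbours T3 1 = {}"
  "nonroot_neighbours T3 2 = {}"
  unfolding nonroot_neighbours_def T3_def ugraph.simps rooted_graph.simps filter_insert
  by (simp_all add: doubleton_eq_iff)

lemma nonroot_neighbours_T4:
  "nonroot_neighbours T4 0 = {1, 2, 3}"
  "nonroot_neighbours T4 1 = {}"
  "nonroot_neighbours T4 2 = {}"
  "nonroot_neighbours T4 3 = {}"
  unfolding nonroot_neighbours_def T4_def ugraph.simps rooted_graph.simps filter_insert
  by (simp_all add: doubleton_eq_iff)

lemma nonroot_neighbours_T5:
  "nonroot_neighbours T5 0 = {}"
  unfolding nonroot_neighbours_def T5_def ugraph.simps rooted_graph.simps filter_insert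
  by (simp_all add: doubleton_eq_iff)

locale tree_iso = ultrametric_space +
  fixes f :: "'a set \<Rightarrow> 'w" and H :: "('w, 'c) rooted_graph_scheme"
  assumes finite_space: "finite M"
    and bij: "bij_betw f (rep_nodes M d) (verts H)"
    and root: "f M = root_of H"
    and edge_iff: "\<And>u v. u \<in> rep_nodes M d \<Longrightarrow> v \<in> rep_nodes M d \<Longrightarrow>
      {u, v} \<in> edges (representing_tree M d) \<longleftrightarrow> {f u, f v} \<in> edges H"
begin

lemma node_subset: "A \<in> rep_nodes M d \<Longrightarrow> A \<subseteq> M"
proof (induction rule: rep_nodes.induct)
  case (child A C)
  note fin = finite_subset[OF child.IH finite_space]
  have "C \<subseteq> \<Union>(parts (diametrical_graph d A))"
    using child.hyps(3) by (rule Union_upper)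
  also have "\<dots> = A"
    by (rule partition_onD1[OF diametrical_graph_parts(1)[OF fin child.hyps(2) child.IH], symmetric])
  also have "\<dots> \<subseteq> M"
    by (rule child.IH)
  finally show ?case .
qed simp

lemma
  assumes A: "A \<in> rep_nodes M d" "0 < diam d A"
  shows parts_are_nodes: "parts (diametrical_graph d A) \<subseteq> rep_nodes M d"
    and parts_map_neighbours: "f ` parts (diametrical_graph d A) \<subseteq> nonroot_neighbours H (f A)"
    and inj_on_parts: "inj_on f (parts (diametrical_graph d A))"
proof -
  let ?P = "parts (diametrical_graph d A)"
  note fin = finite_subset[OF node_subset[OF A(1)] finite_space]
  note part = diametrical_graph_parts(1,2)[OF fin A(2) node_subset[OF A(1)]]
  show nodes: "?P \<subseteq> rep_nodes M d"
    by (rule subsetI) (rule rep_nodes.child[OF A])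
  note inj = bij_betw_imp_inj_on[OF bij]
  show "inj_on f ?P"
    by (rule inj_on_subset[OF inj nodes])
  show "f ` ?P \<subseteq> nonroot_neighbours H (f A)"
  proof (rule image_subsetI)
    fix C assume C: "C \<in> ?P"
    \<comment> \<open>If a part were the whole space, it would leave no points for a second part.\<close>
    have "C \<noteq> M"
    proof
      assume "C = M"
      then have "A \<subseteq> C"
        using node_subset[OF A(1)] by simp
      have "B = C" if B: "B \<in> ?P" for B
      proof -
        have "B \<noteq> {}" "B \<subseteq> A"
          using part(1) B by (auto simp: partition_on_def)
        then have "B \<inter> C \<noteq> {}"
          using \<open>A \<subseteq> C\<close> by blast
        then show ?thesis
          using partition_onD2[OF part(1)] B C by (auto simp: disjoint_def)
      qed
      then have "?P = {C}"
        using C by blast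
      then show False
        using part(2) by simp
    qed
    have node: "C \<in> rep_nodes M d"
      using nodes C by (rule subsetD)
    have "{A, C} \<in> edges (representing_tree M d)"
      unfolding edges_representing_tree using A C by blast
    then have "{f A, f C} \<in> edges H"
      using edge_iff[OF A(1) node] by simp
    moreover have "f C \<noteq> root_of H"
      using inj_on_eq_iff[OF inj node rep_nodes.root] \<open>C \<noteq> M\<close> root by simp
    moreover have "f C \<in> verts H"
      by (rule bij_betw_apply[OF bij node])
    ultimately show "f C \<in> nonroot_neighbours H (f A)"
      by (simp add: nonroot_neighbours_def)
  qed
qed

text \<open>A node with at least two points is the disjoint union of at least two parts, which \<open>f\<close> maps
  injectively into \<open>N\<close>. So bounds on the sizes of the nodes over \<open>N\<close> add up.\<close>

lemma card_node:
  assumes A: "A \<in> rep_nodes M d" and N: "nonroot_neighbours H (f A) = N" and fin: "finite N"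
    and bound: "\<And>C. C \<in> rep_nodes M d \<Longrightarrow> f C \<in> N \<Longrightarrow> card C \<le> k (f C)"
  shows "card A \<le> 1 \<or> 2 \<le> card N \<and> card A \<le> sum k N"
proof (cases "0 < diam d A")
  case True
  let ?P = "parts (diametrical_graph d A)"
  note finA = finite_subset[OF node_subset[OF A] finite_space]
  note part = diametrical_graph_parts(1,2)[OF finA True node_subset[OF A]]
  note map = parts_are_nodes[OF A True] parts_map_neighbours[OF A True, unfolded N]
    inj_on_parts[OF A True]
  have "2 \<le> card (f ` ?P)"
    using part(2) card_image[OF map(3)] by simp
  also have "\<dots> \<le> card N"
    using fin map(2) by (rule card_mono)
  finally have "2 \<le> card N" .
  moreover have "card A \<le> sum k N"
  proof -
    have "card A \<le> sum card ?P"
      using card_Union_le_sum_card[of ?P] partition_onD1[OF part(1)] by simp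
    also have "\<dots> \<le> (\<Sum>C\<in>?P. k (f C))"
      using bound map(1,2) by (intro sum_mono) blast
    also have "\<dots> = sum k (f ` ?P)"
      using map(3) by (simp add: sum.reindex)
    also have "\<dots> \<le> sum k N"
      by (rule sum_mono2[OF fin map(2)]) simp
    finally show ?thesis .
  qed
  ultimately show ?thesis
    by simp
next
  case False
  then show ?thesis
    using card_le_1_if_no_diam[OF finite_subset[OF node_subset[OF A] finite_space] node_subset[OF A]]
    by simp
qed

text \<open>No room for two children. The bound of each node by its own size, which \<open>inv_into\<close> recovers from
  the image, serves only to satisfy the hypothesis of \<open>card_node\<close>.\<close>

lemma card_leaf:
  assumes "A \<in> rep_nodes M d" "finite (nonroot_neighbours H (f A))"
    and "card (nonroot_neighbours H (f A)) \<le> 1"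
  shows "card A \<le> 1"
  using card_node[OF assms(1) refl assms(2), of "\<lambda>w. card (inv_into (rep_nodes M d) f w)"] assms bij
  by (auto simp: bij_betw_inv_into_left)

end

context ultrametric_space
begin

lemma few_points_or_two_close_pairs_if_iso:
  assumes "finite M"
    and "\<exists>T' \<in> {T1, T2, T3, T4, T5}. rooted_iso (representing_tree M d) T'"
  shows "card M \<le> 3 \<or> two_close_pairs"
proof -
  obtain T' where T': "T' \<in> {T1, T2, T3, T4, T5}" "rooted_iso (representing_tree M d) T'"
    using assms(2) by blast
  then obtain f where "bij_betw f (rep_nodes M d) (verts T')" "f M = root_of T'"
      "\<forall>u \<in> rep_nodes M d. \<forall>v \<in> rep_nodes M d.
         {u, v} \<in> edges (representing_tree M d) \<longleftrightarrow> {f u, f v} \<in> edges T'"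
    unfolding rooted_iso_def by auto
  then interpret tree_iso M d f T'
    using assms(1) by unfold_locales auto
  have M: "M \<in> rep_nodes M d"
    by (rule rep_nodes.root)
  consider "T' = T1" | "T' = T2" | "T' = T3" | "T' = T4" | "T' = T5"
    using T'(1) by blast
  then show ?thesis
  proof cases
    case 1
    have root: "f M = 0"
      using root by (simp add: 1 T1_def)
    note N = nonroot_neighbours_T1[folded 1]
    have leaf: "card C \<le> 1" if "C \<in> rep_nodes M d" "f C \<in> {3, 4, 5, 6}" for C
      using card_leaf[OF that(1)] that(2) N by auto
    have pair: "card C \<le> 2" if C: "C \<in> rep_nodes M d" "f C \<in> {1, 2}" for C
    proof -
      consider "nonroot_neighbours T' (f C) = {3, 4}" | "nonroot_neighbours T' (f C) = {5, 6}"
        using C(2) N by auto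
      then show ?thesis
        by cases (use card_node[OF C(1), of _ "\<lambda>_. 1"] leaf in fastforce)+
    qed
    have "card M \<le> 4"
      using card_node[OF M, of "{1, 2}" "\<lambda>_. 2"] pair N root by auto
    show ?thesis
    proof (cases "card M \<le> 3")
      case False
      then have card: "card M = 4"
        using \<open>card M \<le> 4\<close> by simp
      then have pos: "0 < diam d M"
        using card_le_1_if_no_diam[OF assms(1)] by fastforce
      let ?P = "parts (diametrical_graph d M)"
      note part = diametrical_graph_parts(1,2)[OF assms(1) pos order_refl]
      have image: "f ` ?P \<subseteq> {1, 2}"
        using parts_map_neighbours[OF M pos] root N by simp
      then have "card (f ` ?P) \<le> card {1, 2::nat}"
        by (rule card_mono[rotated]) simp
      then have "card ?P = 2"
        using card_image[OF inj_on_parts[OF M pos]] part(2) by simp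
      then obtain B C where BC: "?P = {B, C}" "B \<noteq> C"
        by (auto simp: card_2_iff)
      have nodes: "B \<in> rep_nodes M d" "C \<in> rep_nodes M d"
        using parts_are_nodes[OF M pos] BC(1) by auto
      have cards: "card B \<le> 2" "card C \<le> 2"
        using pair[OF nodes(1)] pair[OF nodes(2)] image BC(1) by blast+
      have M_eq: "M = B \<union> C"
        using partition_onD1[OF part(1)] BC(1) by simp
      then have "card M \<le> card B + card C"
        using card_Un_le[of B C] by simp
      then have "card B = 2" "card C = 2"
        using card cards by auto
      then obtain a b c e where abce: "B = {a, b}" "a \<noteq> b" "C = {c, e}" "c \<noteq> e"
        by (auto simp: card_2_iff)
      then have M_abce: "M = {a, b, c, e}"
        using M_eq by auto
      have "distinct [a, b, c, e]"
        by (rule card_distinct) (use card M_abce in simp)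
      moreover have "d a b < diam d M" "d c e < diam d M" "\<not> d b c < diam d M"
        using same_part_iff[OF assms(1) pos order_refl, of B B a b]
          same_part_iff[OF assms(1) pos order_refl, of C C c e]
          same_part_iff[OF assms(1) pos order_refl, of B C b c] BC abce by blast+
      then have "d a b < d b c" "d c e < d b c"
        by auto
      ultimately show ?thesis
        using M_abce unfolding two_close_pairs_def by blast
    qed simp
  next
    case 2
    have root: "f M = 0"
      using root by (simp add: 2 T2_def)
    note N = nonroot_neighbours_T2[folded 2]
    have leaf: "card C \<le> 1" if "C \<in> rep_nodes M d" "f C \<in> {1, 3, 4}" for C
      using card_leaf[OF that(1)] that(2) N by auto
    have pair: "card C \<le> 2" if "C \<in> rep_nodes M d" "f C = 2" for C
      using card_node[OF that(1), of "{3, 4}" "\<lambda>_. 1"] that(2) leaf N by fastforce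
    \<comment> \<open>The number of a child of the root happens to bound its size: vertex 1 is a leaf and vertex 2
      has two leaves.\<close>
    have "card C \<le> f C" if "C \<in> rep_nodes M d" "f C \<in> {1, 2}" for C
      using leaf[OF that(1)] pair[OF that(1)] that(2) by auto
    then have "card M \<le> 3"
      using card_node[OF M, of "{1, 2}" "\<lambda>w. w"] root N by auto
    then show ?thesis ..
  next
    case 3
    have root: "f M = 0"
      using root by (simp add: 3 T3_def)
    note N = nonroot_neighbours_T3[folded 3]
    have leaf: "card C \<le> 1" if "C \<in> rep_nodes M d" "f C \<in> {1, 2}" for C
      using card_leaf[OF that(1)] that(2) N by auto
    have "card M \<le> 3"
      using card_node[OF M, of "{1, 2}" "\<lambda>_. 1"] leaf root N by fastforce
    then show ?thesis ..
  next
    case 4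
    have root: "f M = 0"
      using root by (simp add: 4 T4_def)
    note N = nonroot_neighbours_T4[folded 4]
    have leaf: "card C \<le> 1" if "C \<in> rep_nodes M d" "f C \<in> {1, 2, 3}" for C
      using card_leaf[OF that(1)] that(2) N by auto
    have "card M \<le> 3"
      using card_node[OF M, of "{1, 2, 3}" "\<lambda>_. 1"] leaf root N by fastforce
    then show ?thesis ..
  next
    case 5
    have "f M = 0"
      using root by (simp add: 5 T5_def)
    then show ?thesis
      using card_leaf[OF M] nonroot_neighbours_T5 by (simp add: 5)
  qed
qed

end

theorem proposition3p9:
  fixes X :: "'a set" and d :: "'a \<Rightarrow> 'a \<Rightarrow> real"
  assumes "ultrametric_space X d" and "finite X" and "X \<noteq> {}"
  shows "(\<forall>T. minimum_spanning_tree X d T \<longrightarrow> is_path T) \<longleftrightarrow>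
         (\<exists>T' \<in> {T1, T2, T3, T4, T5}. rooted_iso (representing_tree X d) T')"
proof -
  interpret ultrametric_space X d by fact
  let ?S = "card X \<le> 3 \<or> two_close_pairs"
  have "(\<forall>T. minimum_spanning_tree X d T \<longrightarrow> is_path T) \<longleftrightarrow> ?S"
  proof
    assume "\<forall>T. minimum_spanning_tree X d T \<longrightarrow> is_path T"
    then show ?S
      using two_close_pairs_if_all_paths[OF assms(2,3)] by (cases "card X \<le> 3") simp_all
  next
    assume ?S
    then show "\<forall>T. minimum_spanning_tree X d T \<longrightarrow> is_path T"
      by (intro allI impI) (rule all_paths_if_few_points_or_two_close_pairs[OF assms(2)])
  qed
  also have "?S \<longleftrightarrow> (\<exists>T' \<in> {T1, T2, T3, T4, T5}. rooted_iso (representing_tree X d) T')"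
    by (rule iffI[OF iso_if_few_points_or_two_close_pairs[OF assms(2,3)]
          few_points_or_two_close_pairs_if_iso[OF assms(2)]])
  finally show ?thesis .
qed

end
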